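(* Let $T>0$ and let $\nu\in L^1(0,T)$ with $\nu>0$. Then for every $g\in L^\infty(0,T)$, $$J_\nu g\in C^0([0,T])\qquad\text{and}\qquad \|J_\nu g\|_{L^\infty(0,T)}\le N(T)\,\|g\|_{L^\infty(0,T)},$$ where $(J_\nu g)(x)=\int_0^x\nu(x-s)g(s)\,ds$ and $N(x)=\int_0^x\nu(s)\,ds$.
   Context: Functions are real-valued. *)

theory Defs
  imports "HOL-Analysis.Analysis" "HOL-Probability.Essential_Supremum"
begin

text \<open>Elements of the Lebesgue spaces on \<open>(0,T)\<close> are represented by functions on the whole
  real line; the values outside \<open>(0,T)\<close>, and on null subsets of it, are irrelevant.\<close>

definition L1_space :: "real \<Rightarrow> (real \<Rightarrow> real) set" where
  "L1_space T = {f. integrable (lebesgue_on {0<..<T}) f}"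

definition Linf_norm :: "real \<Rightarrow> (real \<Rightarrow> real) \<Rightarrow> ereal" where
  "Linf_norm T f = esssup (lebesgue_on {0<..<T}) (\<lambda>x. ereal \<bar>f x\<bar>)"

definition Linf_space :: "real \<Rightarrow> (real \<Rightarrow> real) set" where
  "Linf_space T = {f. f \<in> borel_measurable (lebesgue_on {0<..<T}) \<and> Linf_norm T f < \<infinity>}"

definition kernel_conv :: "(real \<Rightarrow> real) \<Rightarrow> (real \<Rightarrow> real) \<Rightarrow> real \<Rightarrow> real" where
  "kernel_conv \<nu> g x = (LINT s|lebesgue_on {0..x}. \<nu> (x - s) * g s)"

definition kernel_primitive :: "(real \<Rightarrow> real) \<Rightarrow> real \<Rightarrow> real" where
  "kernel_primitive \<nu> x = (LINT s|lebesgue_on {0..x}. \<nu> s)"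

end

theory Submission
  imports Defs
begin

text \<open>On \<open>[0,T]\<close> the operator is an ordinary convolution on the line. Let \<open>n\<close> be \<open>\<nu>\<close> extended by zero
  outside \<open>(0,T)\<close>, and let \<open>h\<close> be \<open>g\<close>, extended by zero and truncated at the level \<open>M = \<parallel>g\<parallel>\<^sub>\<infinity>\<close>;
  the truncation changes \<open>g\<close> only on a null set and makes the bound \<open>\<bar>h\<bar> \<le> M\<close> hold everywhere.
  Since \<open>n (x - s) h s\<close> vanishes unless \<open>0 < s < x\<close>, the integral of it over the whole line is
  \<open>(J\<^sub>\<nu> g) x\<close> for every \<open>x\<close> in \<open>[0,T]\<close> (\<open>kernel_conv_eq_convolution\<close>).

  Both claims are then facts about the convolution of an integrable \<open>f\<close> with a measurable \<open>h\<close>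
  bounded by \<open>M\<close>. Its absolute value is at most \<open>M\<close> times the \<open>L\<^sup>1\<close> norm of \<open>f\<close>, because Lebesgue
  measure is invariant under \<open>s \<mapsto> x - s\<close> (\<open>convolution_bound\<close>); for \<open>f = n\<close> that norm is \<open>N(T)\<close>, by
  positivity of \<open>\<nu>\<close>. The bound does not involve \<open>x\<close>, so approximating \<open>f\<close> in \<open>L\<^sup>1\<close> approximates the
  convolution uniformly. Continuous functions of compact support are dense in \<open>L\<^sup>1\<close>
  (\<open>integrable_approx_compact_support\<close>), and for such an \<open>f\<close> continuity of the convolution follows
  from dominated convergence. A uniform limit of continuous functions is continuous
  (\<open>convolution_continuous\<close>).\<close>

section \<open>Reflections of the line\<close>

lemma measurable_lebesgue_reflect [measurable]:
  "(\<lambda>s. x - s :: real) \<in> lebesgue \<rightarrow>\<^sub>M lebesgue"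
  using lebesgue_affine_measurable[of "\<lambda>_::real. - 1" x] by simp

lemma distr_lebesgue_reflect:
  "distr lebesgue lebesgue (\<lambda>s. x - s :: real) = lebesgue"
  using lebesgue_real_affine[of "- 1" x] by (simp add: density_1 flip: one_ennreal_def)

lemma
  fixes f :: "real \<Rightarrow> real"
  assumes "integrable lebesgue f"
  shows integrable_lebesgue_reflect: "integrable lebesgue (\<lambda>s. f (x - s))"
    and integral_lebesgue_reflect: "(LINT s|lebesgue. f (x - s)) = (LINT s|lebesgue. f s)"
proof -
  show "integrable lebesgue (\<lambda>s. f (x - s))"
    using assms integrable_distr[OF measurable_lebesgue_reflect, of x f]
    by (simp add: distr_lebesgue_reflect)
  show "(LINT s|lebesgue. f (x - s)) = (LINT s|lebesgue. f s)"
    using assms integral_distr[OF measurable_lebesgue_reflect, of f x]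
    by (simp add: distr_lebesgue_reflect)
qed

section \<open>Approximation in mean by continuous functions of compact support\<close>

text \<open>A measurable function is almost everywhere the limit of continuous functions \<open>g n\<close>, but
  nothing dominates these. So the approximation has two stages: \<open>f\<close> is first truncated, in range
  and in domain, at a level \<open>k\<close>, which costs little in \<open>L\<^sup>1\<close> for large \<open>k\<close>. With \<open>k\<close> fixed, the same
  truncation applied to \<open>g n\<close> is dominated by a multiple of the indicator of an interval and
  converges to the truncation of \<open>f\<close>. The truncations are continuous operations, so the result
  is continuous.\<close>

lemma integrable_approx_compact_support:
  fixes f :: "real \<Rightarrow> real"
  assumes f: "integrable lebesgue f" and "e > 0"
  obtains \<phi> R C where "continuous_on UNIV \<phi>" "\<And>x. \<bar>\<phi> x\<bar> \<le> C" "\<And>x. \<bar>x\<bar> > R \<Longrightarrow> \<phi> x = 0"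
    "integrable lebesgue \<phi>" "(LINT x|lebesgue. \<bar>f x - \<phi> x\<bar>) < e"
proof -
  \<comment> \<open>A plateau function, equal to 1 on \<open>[-k,k]\<close> and to 0 outside \<open>[-k-1,k+1]\<close>.\<close>
  define cut :: "nat \<Rightarrow> real \<Rightarrow> real" where "cut k x = max 0 (min 1 (real k + 1 - \<bar>x\<bar>))" for k x
  define clip :: "nat \<Rightarrow> real \<Rightarrow> real" where "clip k y = max (- real k) (min (real k) y)" for k y
  have clip_cont: "continuous_on UNIV (clip k)" for k
    unfolding clip_def by (intro continuous_intros)
  have cut_cont: "continuous_on UNIV (cut k)" for k
    unfolding cut_def by (intro continuous_intros)
  have clip_le: "\<bar>clip k y\<bar> \<le> real k" "\<bar>clip k y\<bar> \<le> \<bar>y\<bar>" for k y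
    by (auto simp: clip_def)
  have cut_bounds: "0 \<le> cut k x" "cut k x \<le> 1" for k x
    by (auto simp: cut_def)
  have cut_0: "cut k x = 0" if "\<bar>x\<bar> > real k + 1" for k x
    using that by (simp add: cut_def)
  have [measurable]: "f \<in> borel_measurable lebesgue" using f by auto
  have [measurable]: "cut k \<in> borel_measurable lebesgue" "clip k \<in> borel_measurable borel" for k
    using cut_cont clip_cont
    by (auto intro!: borel_measurable_continuous_onI measurable_completion)
  obtain N g where N: "negligible N" and g: "\<And>n. continuous_on UNIV (g n)"
    and lim: "\<And>x. x \<notin> N \<Longrightarrow> (\<lambda>n. g n x) \<longlonglongrightarrow> f x"
    using lebesgue_measurable_imp_measurable_on[of f UNIV] by (auto simp: measurable_on_def lebesgue_on_UNIV_eq)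
  have [measurable]: "g n \<in> borel_measurable lebesgue" for n
    using g by (auto intro!: borel_measurable_continuous_onI measurable_completion)
  have aeN: "AE x in lebesgue. x \<notin> N"
    using N by (simp add: negligible_iff_null_sets AE_not_in)
  define F where "F k x = cut k x * clip k (f x)" for k x
  define G where "G k n x = cut k x * clip k (g n x)" for k n x
  have [measurable]: "F k \<in> borel_measurable lebesgue" "G k n \<in> borel_measurable lebesgue" for k n
    unfolding F_def G_def by measurable
  have prod_le: "\<bar>cut k x * clip k y\<bar> \<le> \<bar>clip k y\<bar>" for k x y
    using cut_bounds[of k x] by (simp add: abs_mult mult_left_le_one_le)
  have box: "integrable lebesgue (\<lambda>x. real k * indicator {- (real k + 1)..real k + 1} x :: real)" for k
    by (intro integrable_mult_right integrable_real_indicator) auto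
  have box_le: "\<bar>cut k x * clip k y\<bar> \<le> real k * indicator {- (real k + 1)..real k + 1} x" for k x y
    using order_trans[OF prod_le[of k x y] clip_le(1)] cut_0[of k x]
    by (auto simp: indicator_def)
  have int_F: "integrable lebesgue (F k)" for k
    by (rule Bochner_Integration.integrable_bound[OF box[of k]]) (use box_le in \<open>auto simp: F_def\<close>)
  have int_G: "integrable lebesgue (G k n)" for k n
    by (rule Bochner_Integration.integrable_bound[OF box[of k]]) (use box_le in \<open>auto simp: G_def\<close>)
  have "(\<lambda>k. LINT x|lebesgue. \<bar>f x - F k x\<bar>) \<longlonglongrightarrow> (LINT x::real|lebesgue. 0)"
  proof (rule integral_dominated_convergence[where w = "\<lambda>x. 2 * \<bar>f x\<bar>"])
    show "integrable lebesgue (\<lambda>x. 2 * \<bar>f x\<bar>)" using f by auto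
    show "AE x in lebesgue. (\<lambda>k. \<bar>f x - F k x\<bar>) \<longlonglongrightarrow> 0"
    proof (rule AE_I2)
      fix x
      \<comment> \<open>At such a level \<open>k\<close> neither truncation affects \<open>f\<close> at \<open>x\<close>.\<close>
      have "eventually (\<lambda>k. real k \<ge> \<bar>x\<bar> + \<bar>f x\<bar>) sequentially"
        using filterlim_real_sequentially by (simp add: filterlim_at_top)
      then have "eventually (\<lambda>k. \<bar>f x - F k x\<bar> = 0) sequentially"
        by eventually_elim (auto simp: F_def cut_def clip_def)
      then show "(\<lambda>k. \<bar>f x - F k x\<bar>) \<longlonglongrightarrow> 0" by (rule tendsto_eventually)
    qed
    show "AE x in lebesgue. norm \<bar>f x - F k x\<bar> \<le> 2 * \<bar>f x\<bar>" for k
    proof (rule AE_I2)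
      fix x
      have "\<bar>F k x\<bar> \<le> \<bar>f x\<bar>"
        unfolding F_def by (rule order_trans[OF prod_le clip_le(2)])
      then show "norm \<bar>f x - F k x\<bar> \<le> 2 * \<bar>f x\<bar>" by simp
    qed
  qed auto
  then have "eventually (\<lambda>k. (LINT x|lebesgue. \<bar>f x - F k x\<bar>) < e / 2) sequentially"
    by (rule order_tendstoD) (use \<open>e > 0\<close> in simp)
  then obtain k where k: "(LINT x|lebesgue. \<bar>f x - F k x\<bar>) < e / 2"
    by (auto simp: eventually_sequentially)
  have "(\<lambda>n. LINT x|lebesgue. \<bar>F k x - G k n x\<bar>) \<longlonglongrightarrow> (LINT x::real|lebesgue. 0)"
  proof (rule integral_dominated_convergence
      [where w = "\<lambda>x. 2 * (real k * indicator {- (real k + 1)..real k + 1} x)"])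
    show "integrable lebesgue (\<lambda>x. 2 * (real k * indicator {- (real k + 1)..real k + 1} x) :: real)"
      using box by (rule integrable_mult_right)
    show "AE x in lebesgue. (\<lambda>n. \<bar>F k x - G k n x\<bar>) \<longlonglongrightarrow> 0"
      using aeN
    proof eventually_elim
      fix x assume "x \<notin> N"
      have "(\<lambda>n. clip k (g n x)) \<longlonglongrightarrow> clip k (f x)"
        using lim[OF \<open>x \<notin> N\<close>] clip_cont[of k]
        by (auto simp: continuous_on_eq_continuous_at intro: isCont_tendsto_compose)
      then have "(\<lambda>n. \<bar>F k x - G k n x\<bar>) \<longlonglongrightarrow> \<bar>F k x - cut k x * clip k (f x)\<bar>"
        unfolding G_def by (intro tendsto_intros)
      then show "(\<lambda>n. \<bar>F k x - G k n x\<bar>) \<longlonglongrightarrow> 0" by (simp add: F_def)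
    qed
    show "AE x in lebesgue. norm \<bar>F k x - G k n x\<bar>
            \<le> 2 * (real k * indicator {- (real k + 1)..real k + 1} x)" for n
    proof (rule AE_I2)
      fix x
      show "norm \<bar>F k x - G k n x\<bar> \<le> 2 * (real k * indicator {- (real k + 1)..real k + 1} x)"
        using box_le[of k x "f x"] box_le[of k x "g n x"] unfolding F_def G_def by simp
    qed
  qed auto
  then have "eventually (\<lambda>n. (LINT x|lebesgue. \<bar>F k x - G k n x\<bar>) < e / 2) sequentially"
    by (rule order_tendstoD) (use \<open>e > 0\<close> in simp)
  then obtain n where n: "(LINT x|lebesgue. \<bar>F k x - G k n x\<bar>) < e / 2"
    by (auto simp: eventually_sequentially)
  have "(LINT x|lebesgue. \<bar>f x - G k n x\<bar>)
      \<le> (LINT x|lebesgue. \<bar>f x - F k x\<bar> + \<bar>F k x - G k n x\<bar>)"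
    using f int_F int_G by (intro integral_mono) auto
  also have "\<dots> = (LINT x|lebesgue. \<bar>f x - F k x\<bar>) + (LINT x|lebesgue. \<bar>F k x - G k n x\<bar>)"
    using f int_F int_G by (intro Bochner_Integration.integral_add) auto
  also have "\<dots> < e" using k n by simp
  finally have close: "(LINT x|lebesgue. \<bar>f x - G k n x\<bar>) < e" .
  show thesis
  proof (rule that[OF _ _ _ int_G close])
    show "continuous_on UNIV (G k n)"
      unfolding G_def using cut_cont[of k] g[of n] clip_cont[of k]
      by (intro continuous_on_mult continuous_on_compose2[OF clip_cont]) auto
    show "\<bar>G k n x\<bar> \<le> real k" for x
      unfolding G_def by (rule order_trans[OF prod_le clip_le(1)])
    show "G k n x = 0" if "\<bar>x\<bar> > real k + 1" for x
      using that by (simp add: G_def cut_0)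
  qed
qed

section \<open>Convolution of an integrable with a bounded function\<close>

lemma convolution_integrable:
  fixes f h :: "real \<Rightarrow> real"
  assumes f: "integrable lebesgue f"
    and h: "h \<in> borel_measurable lebesgue" "\<And>s. \<bar>h s\<bar> \<le> M"
  shows "integrable lebesgue (\<lambda>s. f (x - s) * h s)"
proof (rule Bochner_Integration.integrable_bound)
  show "integrable lebesgue (\<lambda>s. M * \<bar>f (x - s)\<bar>)"
    using integrable_lebesgue_reflect[OF f, of x] by auto
  show "(\<lambda>s. f (x - s) * h s) \<in> borel_measurable lebesgue"
    using integrable_lebesgue_reflect[OF f, of x] h(1) by auto
  show "AE s in lebesgue. norm (f (x - s) * h s) \<le> norm (M * \<bar>f (x - s)\<bar>)"
  proof (rule AE_I2)
    fix s
    have "\<bar>f (x - s)\<bar> * \<bar>h s\<bar> \<le> \<bar>f (x - s)\<bar> * M"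
      by (intro mult_left_mono h(2)) auto
    also have "\<dots> \<le> \<bar>M * \<bar>f (x - s)\<bar>\<bar>" by (simp add: mult.commute)
    finally show "norm (f (x - s) * h s) \<le> norm (M * \<bar>f (x - s)\<bar>)" by (simp add: abs_mult)
  qed
qed

lemma convolution_bound:
  fixes f h :: "real \<Rightarrow> real"
  assumes f: "integrable lebesgue f"
    and h: "h \<in> borel_measurable lebesgue" "\<And>s. \<bar>h s\<bar> \<le> M"
  shows "\<bar>LINT s|lebesgue. f (x - s) * h s\<bar> \<le> M * (LINT s|lebesgue. \<bar>f s\<bar>)"
proof -
  have "\<bar>LINT s|lebesgue. f (x - s) * h s\<bar> \<le> (LINT s|lebesgue. \<bar>f (x - s) * h s\<bar>)"
    by (rule integral_abs_bound)
  also have "\<dots> \<le> (LINT s|lebesgue. M * \<bar>f (x - s)\<bar>)"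
  proof (rule integral_mono)
    show "integrable lebesgue (\<lambda>s. \<bar>f (x - s) * h s\<bar>)"
      using convolution_integrable[OF f h] by auto
    show "integrable lebesgue (\<lambda>s. M * \<bar>f (x - s)\<bar>)"
      using integrable_lebesgue_reflect[OF f, of x] by auto
    show "\<bar>f (x - s) * h s\<bar> \<le> M * \<bar>f (x - s)\<bar>" for s
      unfolding abs_mult mult.commute[of M] by (intro mult_left_mono h(2)) auto
  qed
  also have "\<dots> = M * (LINT s|lebesgue. \<bar>f s\<bar>)"
    using f by (simp add: integral_lebesgue_reflect[of "\<lambda>s. \<bar>f s\<bar>"])
  finally show ?thesis .
qed

text \<open>Compact support provides the dominating function: as \<open>x\<close> stays in a bounded set, the
  integrands \<open>s \<mapsto> \<phi> (x - s) h s\<close> vanish outside one common interval.\<close>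

lemma convolution_continuous_compact_support:
  fixes \<phi> h :: "real \<Rightarrow> real"
  assumes \<phi>: "continuous_on UNIV \<phi>" "\<And>x. \<bar>\<phi> x\<bar> \<le> C" "\<And>x. \<bar>x\<bar> > R \<Longrightarrow> \<phi> x = 0"
    and int: "integrable lebesgue \<phi>"
    and h: "h \<in> borel_measurable lebesgue" "\<And>s. \<bar>h s\<bar> \<le> M"
  shows "continuous_on UNIV (\<lambda>x. LINT s|lebesgue. \<phi> (x - s) * h s)"
  unfolding continuous_on_sequentially
proof (intro allI ballI impI, elim conjE)
  fix X :: "nat \<Rightarrow> real" and x assume X: "X \<longlonglongrightarrow> x"
  then have "Bseq X" by (intro convergent_imp_Bseq convergentI)
  then obtain B where B: "\<And>n. \<bar>X n\<bar> \<le> B" by (auto simp: Bseq_def)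
  have "(\<lambda>n. LINT s|lebesgue. \<phi> (X n - s) * h s) \<longlonglongrightarrow> (LINT s|lebesgue. \<phi> (x - s) * h s)"
  proof (rule integral_dominated_convergence
      [where w = "\<lambda>s. C * M * indicator {- (B + R)..B + R} s"])
    show "(\<lambda>s. \<phi> (x - s) * h s) \<in> borel_measurable lebesgue"
      "(\<lambda>s. \<phi> (X n - s) * h s) \<in> borel_measurable lebesgue" for n
      using convolution_integrable[OF int h] by auto
    show "integrable lebesgue (\<lambda>s. C * M * indicator {- (B + R)..B + R} s :: real)"
      by (intro integrable_mult_right integrable_real_indicator) (auto simp: emeasure_lborel_Icc_eq)
    show "AE s in lebesgue. (\<lambda>n. \<phi> (X n - s) * h s) \<longlonglongrightarrow> \<phi> (x - s) * h s"
    proof (rule AE_I2)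
      fix s
      have "(\<lambda>n. \<phi> (X n - s)) \<longlonglongrightarrow> \<phi> (x - s)"
        using \<phi>(1) by (intro isCont_tendsto_compose[of _ \<phi>] tendsto_intros X)
          (auto simp: continuous_on_eq_continuous_at)
      then show "(\<lambda>n. \<phi> (X n - s) * h s) \<longlonglongrightarrow> \<phi> (x - s) * h s"
        by (intro tendsto_intros)
    qed
    show "AE s in lebesgue. norm (\<phi> (X n - s) * h s) \<le> C * M * indicator {- (B + R)..B + R} s" for n
    proof (rule AE_I2)
      fix s
      show "norm (\<phi> (X n - s) * h s) \<le> C * M * indicator {- (B + R)..B + R} s"
      proof (cases "\<bar>X n - s\<bar> > R")
        case True
        have "0 \<le> C * M"
          by (intro mult_nonneg_nonneg order_trans[OF abs_ge_zero \<phi>(2)] order_trans[OF abs_ge_zero h(2)])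
        then show ?thesis using True \<phi>(3) by simp
      next
        case False
        then have "s \<in> {- (B + R)..B + R}" using B[of n] by auto
        moreover have "\<bar>\<phi> (X n - s)\<bar> * \<bar>h s\<bar> \<le> C * M"
          by (intro mult_mono \<phi>(2) h(2) order_trans[OF abs_ge_zero \<phi>(2)]) auto
        ultimately show ?thesis by (simp add: abs_mult)
      qed
    qed
  qed
  then show "((\<lambda>x. LINT s|lebesgue. \<phi> (x - s) * h s) \<circ> X) \<longlonglongrightarrow> (LINT s|lebesgue. \<phi> (x - s) * h s)"
    by (simp add: o_def)
qed

text \<open>By \<open>convolution_bound\<close>, \<open>L\<^sup>1\<close> convergence of the first factor gives uniform convergence of the
  convolutions, so continuity passes from the dense class to all integrable functions.\<close>

lemma convolution_continuous:
  fixes f h :: "real \<Rightarrow> real"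
  assumes f: "integrable lebesgue f"
    and h: "h \<in> borel_measurable lebesgue" "\<And>s. \<bar>h s\<bar> \<le> M"
  shows "continuous_on UNIV (\<lambda>x. LINT s|lebesgue. f (x - s) * h s)"
proof -
  have M: "0 \<le> M" by (rule order_trans[OF abs_ge_zero h(2)])
  have "\<exists>\<psi>. continuous_on UNIV \<psi> \<and> (\<forall>x. \<bar>\<psi> x - (LINT s|lebesgue. f (x - s) * h s)\<bar> < inverse (Suc n))"
    for n
  proof -
    \<comment> \<open>Dividing by \<open>M + 1\<close> rather than by \<open>M\<close> includes the case \<open>M = 0\<close>.\<close>
    have "inverse (Suc n) / (M + 1) > 0" using M by simp
    then show ?thesis
    proof (rule integrable_approx_compact_support[OF f])
      fix \<phi> R C
      assume \<phi>: "continuous_on UNIV \<phi>" "\<And>x. \<bar>\<phi> x\<bar> \<le> C" "\<And>x. \<bar>x\<bar> > R \<Longrightarrow> \<phi> x = 0" "integrable lebesgue \<phi>"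
        and close: "(LINT x|lebesgue. \<bar>f x - \<phi> x\<bar>) < inverse (Suc n) / (M + 1)"
      have "\<bar>(LINT s|lebesgue. \<phi> (x - s) * h s) - (LINT s|lebesgue. f (x - s) * h s)\<bar> < inverse (Suc n)" for x
      proof -
        have "(LINT s|lebesgue. f (x - s) * h s) - (LINT s|lebesgue. \<phi> (x - s) * h s)
            = (LINT s|lebesgue. (f (x - s) - \<phi> (x - s)) * h s)"
          unfolding left_diff_distrib
          using convolution_integrable[OF f h] convolution_integrable[OF \<phi>(4) h]
          by (rule Bochner_Integration.integral_diff[symmetric])
        also have "\<bar>\<dots>\<bar> \<le> M * (LINT s|lebesgue. \<bar>f s - \<phi> s\<bar>)"
          using f \<phi>(4) by (intro convolution_bound[where f = "\<lambda>s. f s - \<phi> s"] h) auto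
        also have "\<dots> \<le> (M + 1) * (LINT s|lebesgue. \<bar>f s - \<phi> s\<bar>)"
          by (intro mult_right_mono integral_nonneg_AE) auto
        also have "\<dots> < inverse (Suc n)"
          using close M by (simp add: pos_less_divide_eq mult.commute)
        finally show ?thesis by (simp add: abs_minus_commute)
      qed
      then show ?thesis
        by (intro exI[of _ "\<lambda>x. LINT s|lebesgue. \<phi> (x - s) * h s"] conjI allI
            convolution_continuous_compact_support[OF \<phi> h])
    qed
  qed
  then have "\<exists>\<psi>. \<forall>n. continuous_on UNIV (\<psi> n) \<and>
      (\<forall>x. \<bar>\<psi> n x - (LINT s|lebesgue. f (x - s) * h s)\<bar> < inverse (Suc n))"
    by (intro choice allI)
  then obtain \<psi> where \<psi>: "\<And>n. continuous_on UNIV (\<psi> n)"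
    and close: "\<And>n x. \<bar>\<psi> n x - (LINT s|lebesgue. f (x - s) * h s)\<bar> < inverse (Suc n)"
    by blast
  have "uniform_limit UNIV \<psi> (\<lambda>x. LINT s|lebesgue. f (x - s) * h s) sequentially"
  proof (rule uniform_limitI)
    fix e :: real assume "e > 0"
    with LIMSEQ_inverse_real_of_nat have "\<forall>\<^sub>F n in sequentially. inverse (real (Suc n)) < e"
      by (rule order_tendstoD)
    then show "\<forall>\<^sub>F n in sequentially. \<forall>x\<in>UNIV. dist (\<psi> n x) (LINT s|lebesgue. f (x - s) * h s) < e"
      unfolding dist_real_def by eventually_elim (rule ballI, rule less_trans[OF close])
  qed
  then show ?thesis
    by (rule uniform_limit_theorem[rotated]) (use \<psi> in auto)
qed

section \<open>The operator on the interval\<close>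

text \<open>The endpoints \<open>s = 0\<close> and \<open>s = x\<close> are exceptional, because there \<open>\<nu> (x - s) * g s\<close> uses values of
  \<open>\<nu>\<close> or \<open>g\<close> at 0, which are arbitrary. Together with the points where
  \<open>\<bar>g s\<bar> > M\<close> they form a null set.\<close>

lemma kernel_conv_eq_convolution:
  fixes \<nu> g :: "real \<Rightarrow> real"
  assumes \<nu>: "integrable (lebesgue_on {0<..<T}) \<nu>"
    and g: "g \<in> borel_measurable (lebesgue_on {0<..<T})"
    and M: "AE s in lebesgue_on {0<..<T}. \<bar>g s\<bar> \<le> M" "0 \<le> M"
    and x: "x \<in> {0..T}"
  shows "kernel_conv \<nu> g x = (LINT s|lebesgue. (if x - s \<in> {0<..<T} then \<nu> (x - s) else 0) *
           max (- M) (min M (if s \<in> {0<..<T} then g s else 0)))"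
    (is "_ = (LINT s|lebesgue. ?F s)")
proof -
  have "integrable lebesgue (\<lambda>s. if s \<in> {0<..<T} then \<nu> s else 0)"
    using \<nu> by (subst Lebesgue_Measure.integrable_restrict_UNIV) auto
  moreover have h: "(\<lambda>s. if s \<in> {0<..<T} then g s else 0) \<in> borel_measurable lebesgue"
    using g by (subst borel_measurable_if) auto
  ultimately have meas: "?F \<in> borel_measurable lebesgue"
    using integrable_lebesgue_reflect[of "\<lambda>s. if s \<in> {0<..<T} then \<nu> s else 0" x]
    by (intro borel_measurable_times borel_measurable_max borel_measurable_min) auto
  have "AE s in lebesgue. s \<noteq> 0 \<and> s \<noteq> x"
    by (intro AE_conjI AE_completion AE_lborel_singleton)
  moreover have "AE s in lebesgue. s \<in> {0<..<T} \<longrightarrow> \<bar>g s\<bar> \<le> M"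
    using M(1) by (simp add: AE_restrict_space_iff)
  ultimately have ae: "AE s in lebesgue. ?F s = (if s \<in> {0..x} then \<nu> (x - s) * g s else 0)"
  proof eventually_elim
    case (elim s)
    then show ?case using x M(2) by (auto simp: max_def min_def)
  qed
  have "kernel_conv \<nu> g x = (LINT s|lebesgue. (if s \<in> {0..x} then \<nu> (x - s) * g s else 0))"
    unfolding kernel_conv_def by (subst Lebesgue_Measure.integral_restrict_UNIV) auto
  also have "\<dots> = (LINT s|lebesgue. ?F s)"
    using meas borel_measurable_AE[OF meas ae] ae by (rule integral_cong_AE[symmetric])
  finally show ?thesis .
qed

lemma kernel_primitive_eq_L1_norm:
  assumes \<nu>: "integrable (lebesgue_on {0<..<T}) \<nu>"
    and pos: "AE x in lebesgue_on {0<..<T}. \<nu> x > 0"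
  shows "kernel_primitive \<nu> T = (LINT s|lebesgue. \<bar>(if s \<in> {0<..<T} then \<nu> s else 0)\<bar>)"
proof -
  have meas: "(\<lambda>s. \<bar>(if s \<in> {0<..<T} then \<nu> s else 0)\<bar>) \<in> borel_measurable lebesgue"
    using \<nu> by (intro borel_measurable_abs, subst borel_measurable_if) auto
  have "AE s in lebesgue. s \<noteq> 0 \<and> s \<noteq> T"
    by (intro AE_conjI AE_completion AE_lborel_singleton)
  moreover have "AE s in lebesgue. s \<in> {0<..<T} \<longrightarrow> \<nu> s > 0"
    using pos by (simp add: AE_restrict_space_iff)
  ultimately have ae: "AE s in lebesgue.
      \<bar>(if s \<in> {0<..<T} then \<nu> s else 0)\<bar> = (if s \<in> {0..T} then \<nu> s else 0)"
    by eventually_elim auto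
  have "kernel_primitive \<nu> T = (LINT s|lebesgue. (if s \<in> {0..T} then \<nu> s else 0))"
    unfolding kernel_primitive_def by (subst Lebesgue_Measure.integral_restrict_UNIV) auto
  also have "\<dots> = (LINT s|lebesgue. \<bar>(if s \<in> {0<..<T} then \<nu> s else 0)\<bar>)"
    using meas borel_measurable_AE[OF meas ae] ae by (rule integral_cong_AE[symmetric])
  finally show ?thesis .
qed

text \<open>The interval must have positive measure: over a null space every essential supremum
  of a measurable function is \<open>-\<infinity>\<close>, even that of an absolute value.\<close>

lemma Linf_norm_nonneg:
  assumes "T > 0"
  shows "0 \<le> Linf_norm T g"
proof (rule ccontr)
  assume neg: "\<not> 0 \<le> Linf_norm T g"
  have "AE x in lebesgue_on {0<..<T}. ereal \<bar>g x\<bar> \<le> Linf_norm T g"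
    unfolding Linf_norm_def by (rule esssup_AE)
  then have "AE x in lebesgue_on {0<..<T}. False"
  proof eventually_elim
    case (elim x)
    have "0 \<le> ereal \<bar>g x\<bar>" by simp
    with elim have "0 \<le> Linf_norm T g" by (rule order_trans[rotated])
    with neg show False by contradiction
  qed
  then show False
    using assms by (simp add: eventually_False ae_filter_eq_bot_iff emeasure_restrict_space)
qed

theorem proposition4p2:
  fixes T :: real and \<nu> :: "real \<Rightarrow> real"
  assumes "T > 0"
    and "\<nu> \<in> L1_space T"
    and "AE x in lebesgue_on {0<..<T}. \<nu> x > 0"
  shows "\<forall>g \<in> Linf_space T.
           continuous_on {0..T} (kernel_conv \<nu> g) \<and>
           Linf_norm T (kernel_conv \<nu> g) \<le> ereal (kernel_primitive \<nu> T) * Linf_norm T g"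
proof
  fix g assume "g \<in> Linf_space T"
  then have g: "g \<in> borel_measurable (lebesgue_on {0<..<T})" and "Linf_norm T g < \<infinity>"
    by (auto simp: Linf_space_def)
  with Linf_norm_nonneg[OF \<open>T > 0\<close>, of g] obtain M where M: "Linf_norm T g = ereal M" "0 \<le> M"
    by (cases "Linf_norm T g") auto
  have g_le: "AE s in lebesgue_on {0<..<T}. \<bar>g s\<bar> \<le> M"
    using esssup_AE[of "\<lambda>x. ereal \<bar>g x\<bar>" "lebesgue_on {0<..<T}"] M by (simp add: Linf_norm_def)
  have \<nu>: "integrable (lebesgue_on {0<..<T}) \<nu>"
    using assms(2) by (simp add: L1_space_def)
  define n where "n s = (if s \<in> {0<..<T} then \<nu> s else 0)" for s
  define h where "h s = max (- M) (min M (if s \<in> {0<..<T} then g s else 0))" for s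
  have n: "integrable lebesgue n"
    unfolding n_def using \<nu> by (subst Lebesgue_Measure.integrable_restrict_UNIV) auto
  have "(\<lambda>s. if s \<in> {0<..<T} then g s else 0) \<in> borel_measurable lebesgue"
    using g by (subst borel_measurable_if) auto
  then have h: "h \<in> borel_measurable lebesgue" "\<And>s. \<bar>h s\<bar> \<le> M"
    unfolding h_def using M(2) by (auto intro!: borel_measurable_max borel_measurable_min)
  have eq: "kernel_conv \<nu> g x = (LINT s|lebesgue. n (x - s) * h s)" if "x \<in> {0..T}" for x
    using kernel_conv_eq_convolution[OF \<nu> g g_le M(2) that] by (simp only: n_def h_def)
  have cont: "continuous_on {0..T} (kernel_conv \<nu> g)"
    by (subst continuous_on_cong[OF refl eq])
      (auto intro: continuous_on_subset[OF convolution_continuous[OF n h]])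
  have "\<bar>kernel_conv \<nu> g x\<bar> \<le> kernel_primitive \<nu> T * M" if "x \<in> {0<..<T}" for x
    using convolution_bound[OF n h, of x] eq[of x] that
      kernel_primitive_eq_L1_norm[OF \<nu> assms(3)]
    by (simp add: n_def[abs_def] mult.commute)
  then have "Linf_norm T (kernel_conv \<nu> g) \<le> ereal (kernel_primitive \<nu> T * M)"
    unfolding Linf_norm_def
  proof (intro esssup_I AE_I2)
    have "continuous_on {0<..<T} (kernel_conv \<nu> g)"
      using cont by (rule continuous_on_subset) auto
    then have "kernel_conv \<nu> g \<in> borel_measurable (lebesgue_on {0<..<T})"
      by (rule continuous_imp_measurable_on_sets_lebesgue) auto
    then show "(\<lambda>x. ereal \<bar>kernel_conv \<nu> g x\<bar>) \<in> borel_measurable (lebesgue_on {0<..<T})"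
      by auto
  qed auto
  with cont M(1) show "continuous_on {0..T} (kernel_conv \<nu> g) \<and>
      Linf_norm T (kernel_conv \<nu> g) \<le> ereal (kernel_primitive \<nu> T) * Linf_norm T g"
    by simp
qed

end
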